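(* Let $q\ge 5$ be a power of an odd prime, let $m\ge 1$ be an integer that does not divide $q-1$, and let $a\in\mathbb{F}_q$ be such that $x^m-a$ is irreducible over $\mathbb{F}_q$. Let $\theta$ be the coset of $x$ in the field $\mathbb{F}_q(\theta)=\mathbb{F}_q[x]/(x^m-a)$, and let $b$ be any non-zero element of $\mathbb{F}_q$. Then the multiplicative order of $\theta+b$ in $\mathbb{F}_q(\theta)$ is at least $2^{\sqrt{2m}}$.
   Context: $\mathbb{F}_q$ denotes the finite field with $q$ elements. The multiplicative order of a non-zero element is its order in the multiplicative group of the field $\mathbb{F}_q[x]/(x^m-a)\cong\mathbb{F}_{q^m}$. *)

theory Defs
  imports Complex_Main "HOL-Algebra.Algebra"
begin

text \<open>
  Polynomials over a ring \<open>F\<close> are the coefficient lists of \<^theory>\<open>HOL-Algebra.Polynomials\<close>,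
  and \<^const>\<open>rupture\<close> is the quotient of the polynomial ring by a principal ideal.
\<close>

definition binomial_poly :: "('a, 'b) ring_scheme \<Rightarrow> nat \<Rightarrow> 'a \<Rightarrow> 'a list" where
  "binomial_poly F m a =
     (X\<^bsub>F\<^esub> [^]\<^bsub>poly_ring F\<^esub> m) \<ominus>\<^bsub>poly_ring F\<^esub> ring.poly_of_const F a"

definition binomial_ext :: "('a, 'b) ring_scheme \<Rightarrow> nat \<Rightarrow> 'a \<Rightarrow> 'a list set ring" where
  "binomial_ext F m a = Rupt\<^bsub>F\<^esub> (carrier F) (binomial_poly F m a)"

definition binomial_coset :: "('a, 'b) ring_scheme \<Rightarrow> nat \<Rightarrow> 'a \<Rightarrow> 'a list \<Rightarrow> 'a list set" where
  "binomial_coset F m a g = ring.rupture_surj F (carrier F) (binomial_poly F m a) g"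

text \<open>
  An element \<open>b\<close> of \<open>F\<close> is regarded as an element of the extension through the coset of
  the constant polynomial \<open>b\<close>.
\<close>

definition binomial_root :: "('a, 'b) ring_scheme \<Rightarrow> nat \<Rightarrow> 'a \<Rightarrow> 'a list set" where
  "binomial_root F m a = binomial_coset F m a X\<^bsub>F\<^esub>"

definition binomial_const :: "('a, 'b) ring_scheme \<Rightarrow> nat \<Rightarrow> 'a \<Rightarrow> 'a \<Rightarrow> 'a list set" where
  "binomial_const F m a b = binomial_coset F m a (ring.poly_of_const F b)"

end

theory Submission
  imports
    Defs
    "HOL-Computational_Algebra.Squarefree"
    "HOL-Number_Theory.Number_Theory"
begin

text \<open>
  Write \<open>F\<close> for the base field, \<open>q\<close> for its order and \<open>K = F(\<theta>)\<close> for the extension, of degree \<open>m\<close>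
  with \<open>\<theta>\<^sup>m \<in> F\<close>. Many distinct powers of \<open>\<theta> + b\<close> are exhibited as products of conjugates of
  \<open>\<theta> + b\<close>: by additivity of the Frobenius map, \<open>\<theta> + b\<close> raised to a power \<open>q\<^sup>i\<close> is the
  \<open>i\<close>-th conjugate of \<open>\<theta>\<close>, plus \<open>b\<close>. The idea is to choose an intermediate field \<open>L = F(\<theta>\<^sup>M)\<close>, with
  \<open>M\<close> dividing \<open>m\<close>, over which sufficiently many of these conjugates become linear polynomials in \<open>\<theta>\<close>.

  If \<open>M\<close> divides \<open>q\<^sup>e - 1\<close>, then for every \<open>t\<close> the \<open>e t\<close>-th conjugate of \<open>\<theta>\<close> is \<open>g\<^sub>t \<theta>\<close> with
  \<open>g\<^sub>t \<in> L\<close>. For \<open>B\<close> values of \<open>t\<close>, where \<open>e B \<le> m\<close>, these conjugates are distinct, and the products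
  \<open>\<Prod> (g\<^sub>t \<theta> + b)\<close> with exponents \<open>u\<^sub>t\<close> of sum at most \<open>M - 1\<close> are the values at \<open>\<theta>\<close> of
  polynomials over \<open>L\<close> of degree less than \<open>M\<close>. Since \<open>\<theta>\<close> has degree exactly \<open>M\<close> over \<open>L\<close>, equal
  values force equal polynomials, and the multiplicities of their roots \<open>- b / g\<^sub>t\<close> recover the
  exponents. This gives \<open>(M - 1 + B) choose B\<close> distinct powers of \<open>\<theta> + b\<close>
  (lemma \<open>ord_root_plus_const_ge_binomial\<close>).

  It remains to choose \<open>M\<close>. Every prime divisor of \<open>m\<close> divides \<open>q - 1\<close>
  (lemma \<open>prime_divisor_of_degree_dvd\<close>). Put \<open>d = gcd m (q - 1)\<close> and \<open>m = d s\<close>; then every prime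
  divisor of \<open>s\<close> divides \<open>d\<close>, so that \<open>d e\<close> divides \<open>q\<^sup>e - 1\<close> for each divisor \<open>e\<close> of \<open>s\<close>. With
  \<open>s = f D\<^sup>2\<close> and \<open>f\<close> squarefree, the choice \<open>e = f D\<close>, \<open>M = d e\<close>, \<open>B = d D\<close> makes \<open>M\<close> and \<open>B\<close> both
  at least \<open>\<surd>m\<close>: the squarefree \<open>f\<close> divides \<open>d\<close>, hence \<open>B\<^sup>2 = d m / f \<ge> m\<close>, while
  \<open>M = B f\<close>. For \<open>f \<ge> 2\<close> the binomial coefficient is at least \<open>3\<^sup>B\<close>, which suffices. For
  \<open>f = 1\<close> the lower bound is only \<open>2\<^sup>B\<close>, but then \<open>B\<^sup>2 = d m \<ge> 2 m\<close>, which suffices again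
  (lemma \<open>balanced_tower_parameters\<close>). That \<open>m\<close> does not divide \<open>q - 1\<close> means \<open>s \<ge> 2\<close>; this excludes
  \<open>f = D = 1\<close>, where \<open>M = B = d\<close> could be as small as \<open>2\<close>.
\<close>

section \<open>Arithmetic of the parameters\<close>

text \<open>
  Going from \<open>k - 1\<close> to \<open>k\<close> multiplies \<open>(n + k) choose k\<close> by \<open>(n + k) / k\<close>, which is at least \<open>c + 1\<close>
  as long as \<open>c * k \<le> n\<close>. The first factor \<open>n + 1\<close> is much larger; it is kept separate because it has
  to compensate for a deficient last factor in the exponential bounds below.
\<close>

lemma binomial_lower_bound:
  fixes n k c :: nat
  assumes "c * k \<le> n" and "k \<ge> 1"
  shows "(n + 1) * (c + 1) ^ (k - 1) \<le> (n + k) choose k"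
  using assms(2,1)
proof (induction k rule: dec_induct)
  case base
  then show ?case by simp
next
  case (step k)
  from step.prems have ck: "(c + 1) * Suc k \<le> Suc (n + k)" by simp
  have IH: "(n + 1) * (c + 1) ^ (k - 1) \<le> (n + k) choose k"
    using step by simp
  have "Suc k * ((n + 1) * (c + 1) ^ k) = ((c + 1) * Suc k) * ((n + 1) * (c + 1) ^ (k - 1))"
  proof -
    have "(c + 1) ^ k = (c + 1) * (c + 1) ^ (k - 1)"
      using step.hyps(1) by (simp add: power_eq_if)
    then show ?thesis by (simp only: mult_ac)
  qed
  also have "\<dots> \<le> Suc (n + k) * ((n + k) choose k)"
    using mult_le_mono[OF ck IH] .
  also have "\<dots> = Suc k * (Suc (n + k) choose Suc k)"
    using Suc_times_binomial_eq[of "n + k" k] by (simp add: mult.commute)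
  finally show ?case by (simp del: mult_Suc mult_Suc_right)
qed

text \<open>
  The factor \<open>(n + B) / B\<close> of the last step can be slightly less than \<open>3\<close>; the first factor \<open>n + 1 \<ge> 2 * B\<close>
  compensates for this.
\<close>

lemma binomial_ge_three_power:
  fixes n B :: nat
  assumes "B \<ge> 2" and "2 * B - 1 \<le> n"
  shows "3 ^ B \<le> (n + B) choose B"
proof -
  obtain k where k: "B = Suc (Suc k)" using assms(1) that[of "B - 2"] by simp
  have "(n + 1) * 3 ^ k \<le> (n + Suc k) choose Suc k"
    using binomial_lower_bound[of 2 "Suc k" n] assms(2) k by simp
  moreover have "9 * B \<le> (n + B) * (n + 1)"
  proof -
    have "9 * B \<le> (3 * B - 1) * (2 * B)" using k by (simp add: algebra_simps)
    also have "\<dots> \<le> (n + B) * (n + 1)" using assms by (intro mult_le_mono) auto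
    finally show ?thesis .
  qed
  ultimately have "9 * B * 3 ^ k \<le> (n + B) * ((n + Suc k) choose Suc k)"
    using mult_le_mono1[of "9 * B" "(n + B) * (n + 1)" "3 ^ k"]
      mult_le_mono2[of "(n + 1) * 3 ^ k" "(n + Suc k) choose Suc k" "n + B"]
    by (simp only: mult.assoc) (blast intro: le_trans)
  also have "\<dots> = B * ((n + B) choose B)"
    using Suc_times_binomial_eq[of "n + Suc k" "Suc k"] k by (simp add: mult.commute)
  also have "9 * B * 3 ^ k = B * 3 ^ B" using k by (simp add: algebra_simps)
  finally have "B * 3 ^ B \<le> B * ((n + B) choose B)" .
  then show ?thesis using assms(1) by simp
qed

text \<open>
  By symmetry there are only \<open>B - 1\<close> steps, the first of which contributes the factor \<open>B\<close> and the others
  at least \<open>2\<close> each; \<open>B \<ge> 4\<close> supplies the two missing factors \<open>2\<close>.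
\<close>

lemma central_binomial_ge_two_power:
  fixes B :: nat
  assumes "B \<ge> 4"
  shows "2 ^ B \<le> (B - 1 + B) choose B"
proof -
  obtain k where k: "B = Suc (Suc k)" using assms that[of "B - 2"] by simp
  have "2 ^ B \<le> B * 2 ^ k" using assms k by simp
  also have "\<dots> \<le> (Suc k + Suc k) choose Suc k"
    using binomial_lower_bound[of 1 "Suc k" "Suc k"] k by (simp add: numeral_2_eq_2)
  also have "\<dots> \<le> (B - 1 + B) choose B"
    using k by simp
  finally show ?thesis .
qed

lemma squarefree_dvd_of_prime_divisors:
  fixes f d :: nat
  assumes "squarefree f" and "d > 0" and "\<And>l. Factorial_Ring.prime l \<Longrightarrow> l dvd f \<Longrightarrow> l dvd d"
  shows "f dvd d"
proof (rule multiplicity_le_imp_dvd)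
  show "f \<noteq> 0" using assms(1) by (metis not_squarefree_0)
  fix l :: nat assume l: "Factorial_Ring.prime l"
  show "multiplicity l f \<le> multiplicity l d"
  proof (cases "l dvd f")
    case True
    then have "multiplicity l f = 1" using assms(1) l \<open>f \<noteq> 0\<close>
      by (simp add: squarefree_factorial_semiring' prime_factors_dvd)
    moreover have "multiplicity l d \<ge> 1"
      using assms(2,3) True l by (intro multiplicity_geI) auto
    ultimately show ?thesis by simp
  qed (simp add: not_dvd_imp_multiplicity_0)
qed

text \<open>
  Each prime factor \<open>l\<close> of \<open>e\<close> gains one factor: if \<open>l\<close> divides \<open>r - 1\<close>, then
  \<open>r\<^sup>l - 1 = (r - 1) * (\<Sum>i<l. r ^ i)\<close>, and the sum is congruent to \<open>l\<close>, hence to \<open>0\<close>, modulo \<open>l\<close>.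
\<close>

lemma mult_dvd_power_pred:
  fixes q e N :: nat
  assumes "q \<ge> 1" and "e \<ge> 1" and "\<And>l. Factorial_Ring.prime l \<Longrightarrow> l dvd e \<Longrightarrow> l dvd N" and "N dvd q - 1"
  shows "N * e dvd q ^ e - 1"
  using assms(2,3)
proof (induction e rule: nat_less_induct)
  case (1 e)
  show ?case
  proof (cases "e = 1")
    case True
    then show ?thesis using assms(4) by simp
  next
    case False
    then obtain l where l: "Factorial_Ring.prime l" "l dvd e" using prime_factor_nat by blast
    then obtain e' where e: "e = l * e'" by (auto elim: dvdE)
    have e': "e' < e" "e' \<ge> 1" using e l 1(2) prime_gt_1_nat[of l] by (auto intro: Suc_leI)
    then have IH: "N * e' dvd q ^ e' - 1" using 1 e by simp
    define r where "r = q ^ e'"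
    have r: "r \<ge> 1" using assms(1) by (simp add: r_def)
    have "l dvd N" using 1 l by blast
    then have "l dvd r - 1" using IH unfolding r_def by (meson dvd_trans dvd_triv_left)
    then have "l dvd (\<Sum>i<l. r ^ i)"
    proof -
      have "[r = 1] (mod l)" using \<open>l dvd r - 1\<close> r by (simp add: cong_altdef_nat)
      then have "[(\<Sum>i<l. r ^ i) = (\<Sum>i<l. 1 ^ i)] (mod l)"
        by (intro cong_sum cong_pow) auto
      then show ?thesis by (simp add: cong_0_iff cong_def mod_eq_0_iff_dvd)
    qed
    then have "N * e' * l dvd (r - 1) * (\<Sum>i<l. r ^ i)"
      using IH unfolding r_def by (rule mult_dvd_mono[rotated])
    also have "(r - 1) * (\<Sum>i<l. r ^ i) = r ^ l - 1"
    proof -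
      have "int ((r - 1) * (\<Sum>i<l. r ^ i)) = (int r - 1) * (\<Sum>i<l. int r ^ i)"
        using r by (simp add: of_nat_diff)
      also have "\<dots> = int r ^ l - 1" by (rule power_diff_1_eq[symmetric])
      also have "\<dots> = int (r ^ l - 1)" using r by (simp add: of_nat_diff)
      finally show ?thesis by (simp only: of_nat_eq_iff)
    qed
    finally show ?thesis using e by (simp add: r_def power_mult[symmetric] mult_ac)
  qed
qed

lemma dvd_pred_power:
  fixes M x :: nat
  assumes "x \<ge> 1" and "M dvd x - 1"
  shows "M dvd x ^ t - 1"
proof -
  have "[x ^ t = 1 ^ t] (mod (x - 1))"
    using assms(1) by (intro cong_pow) (simp add: cong_altdef_nat)
  then have "x - 1 dvd x ^ t - 1" using assms(1) by (simp add: cong_altdef_nat)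
  then show ?thesis using assms(2) dvd_trans by blast
qed

lemma prime_mult_pred_dvd_power_pred:
  fixes l q :: nat
  assumes l: "Factorial_Ring.prime l" and q: "q \<ge> 1" and "\<not> l dvd q" "\<not> l dvd q - 1"
  shows "l * (q - 1) dvd q ^ (l - 1) - 1"
proof (rule divides_mult)
  have N: "q ^ (l - 1) \<ge> 1" using q by simp
  show "coprime l (q - 1)" using assms(4) l by (simp add: prime_imp_coprime)
  show "l dvd q ^ (l - 1) - 1"
    using fermat_theorem[OF l assms(3)] N by (simp add: cong_altdef_nat)
  have "[q ^ (l - 1) = 1 ^ (l - 1)] (mod (q - 1))"
    using q by (intro cong_pow) (simp add: cong_altdef_nat)
  then show "q - 1 dvd q ^ (l - 1) - 1" using N by (simp add: cong_altdef_nat)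
qed

text \<open>
  The numbers \<open>M = d * e = B * f\<close> (a degree bound) and \<open>B\<close> (a number of conjugates) satisfy
  \<open>M * B = d * (d * s)\<close>, so the binomial coefficient is large when they are balanced. Perfect balance
  needs \<open>s\<close> to be a square; the squarefree part \<open>f\<close> of \<open>s\<close> measures the defect, and \<open>f \<le> d\<close> keeps it
  harmless.
\<close>

lemma balanced_tower_parameters:
  fixes d s :: nat
  assumes "d \<ge> 2" and "s \<ge> 2" and "\<And>l. Factorial_Ring.prime l \<Longrightarrow> l dvd s \<Longrightarrow> l dvd d"
  obtains B f e where "e \<ge> 1" "e dvd s" "d * e = B * f" "e * B = d * s"
    "2 powr sqrt (2 * real (d * s)) \<le> real ((B * f - 1 + B) choose B)"
proof -
  define f where "f = squarefree_part s"
  define D where "D = square_part s"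
  have s: "s = f * D\<^sup>2" unfolding f_def D_def by (rule squarefree_decompose)
  have pos: "f \<ge> 1" "D \<ge> 1" using s assms(2) by (auto simp: Suc_le_eq intro!: gr0I)
  have "squarefree f" unfolding f_def by simp
  moreover have "d > 0" using assms(1) by simp
  moreover have "l dvd d" if "Factorial_Ring.prime l" "l dvd f" for l
    using assms(3)[of l] that s by (metis dvd_mult2)
  ultimately have "f dvd d" by (rule squarefree_dvd_of_prime_divisors)
  then have fd: "f \<le> d" using assms(1) by (simp add: dvd_imp_le)
  define B where "B = d * D"
  have B2: "f * B\<^sup>2 = d * (d * s)" using s by (simp add: B_def power2_eq_square)
  have "2 powr sqrt (2 * real (d * s)) \<le> real ((B * f - 1 + B) choose B)"
  proof (cases "f = 1")
    case True
    then have "D \<ge> 2" using s assms(2) pos by (cases "D = 1") auto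
    then have B4: "B \<ge> 4" using mult_le_mono[OF assms(1) \<open>D \<ge> 2\<close>] by (simp add: B_def)
    have "2 * (d * s) \<le> B\<^sup>2" using B2 True assms(1) mult_le_mono1[of 2 d "d * s"] by simp
    then have "2 * real (d * s) \<le> (real B)\<^sup>2"
      by (metis of_nat_le_iff of_nat_mult of_nat_numeral of_nat_power)
    then have "sqrt (2 * real (d * s)) \<le> real B"
      by (rule real_le_lsqrt[OF of_nat_0_le_iff])
    then have "2 powr sqrt (2 * real (d * s)) \<le> 2 powr real B"
      by (rule powr_mono) simp
    also have "\<dots> = real (2 ^ B)" by (simp add: powr_realpow)
    also have "\<dots> \<le> real ((B * f - 1 + B) choose B)"
      unfolding of_nat_le_iff using central_binomial_ge_two_power[OF B4] True by simp
    finally show ?thesis .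
  next
    case False
    then have f2: "f \<ge> 2" using pos by simp
    have "d * (d * s) \<le> d * B\<^sup>2" unfolding B2[symmetric] using fd by simp
    then have "d * s \<le> B\<^sup>2" using assms(1) by simp
    then have "real (d * s) \<le> (real B)\<^sup>2"
      by (metis of_nat_le_iff of_nat_power)
    \<comment> \<open>The constant \<open>3 / 2\<close> is a rational upper bound for \<open>\<surd>2\<close> that is still small enough:
      \<open>2 powr (3 / 2) \<le> 3\<close>, because \<open>8 \<le> 9\<close>.\<close>
    then have "2 * real (d * s) \<le> (3 / 2 * real B)\<^sup>2"
      by (simp add: power2_eq_square del: of_nat_mult)
    then have "sqrt (2 * real (d * s)) \<le> 3 / 2 * real B"
      by (rule real_le_lsqrt[rotated]) simp
    then have "2 powr sqrt (2 * real (d * s)) \<le> 2 powr (3 / 2 * real B)"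
      by (rule powr_mono) simp
    also have "\<dots> = (2 powr (3 / 2)) ^ B" by (simp add: powr_power mult.commute)
    also have "\<dots> \<le> 3 ^ B"
    proof (rule power_mono)
      have "(2 powr (3 / 2))\<^sup>2 = (2::real) powr 3" by (simp add: powr_power)
      also have "\<dots> \<le> 3\<^sup>2" by simp
      finally show "2 powr (3 / 2) \<le> (3::real)" by (rule power2_le_imp_le) simp
    qed simp
    also have "\<dots> = real (3 ^ B)" by simp
    also have "\<dots> \<le> real ((B * f - 1 + B) choose B)"
      unfolding of_nat_le_iff
    proof (rule binomial_ge_three_power)
      show "B \<ge> 2" using assms(1) pos mult_le_mono[of 2 d 1 D] by (simp add: B_def)
      show "2 * B - 1 \<le> B * f - 1" using f2 by (intro diff_le_mono) simp
    qed
    finally show ?thesis .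
  qed
  moreover have "D * f \<ge> 1" "D * f dvd s" "d * (D * f) = B * f" "D * f * B = d * s"
    using pos s by (auto simp: B_def power2_eq_square)
  ultimately show thesis using that by blast
qed

section \<open>Dimensions, degrees and roots\<close>

lemma (in ring) card_of_dimension:
  assumes "subfield K R" and "finite K" and "dimension n K E"
  shows "card E = card K ^ n"
proof -
  obtain Vs where Vs: "set Vs \<subseteq> carrier R" "independent K Vs" "length Vs = n" "Span K Vs = E"
    using exists_base[OF assms(1,3)] by blast
  let ?C = "{Ks. set Ks \<subseteq> K \<and> length Ks = n}"
  have "bij_betw (\<lambda>Ks. combine Ks Vs) ?C E"
    unfolding bij_betw_def
  proof
    show "(\<lambda>Ks. combine Ks Vs) ` ?C = E"
      using Span_mem_iff_length_version[OF assms(1) Vs(1)] Vs(3,4) by auto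
    show "inj_on (\<lambda>Ks. combine Ks Vs) ?C"
    proof (rule inj_onI)
      fix Ks Ls assume "Ks \<in> ?C" "Ls \<in> ?C" "combine Ks Vs = combine Ls Vs"
      moreover from this have "combine Ks Vs \<in> Span K Vs"
        using Span_mem_iff_length_version[OF assms(1) Vs(1)] Vs(3) by auto
      ultimately show "Ks = Ls"
        using unique_decomposition[OF assms(1) Vs(2), of "combine Ks Vs"] Vs(3) by auto
    qed
  qed
  then have "card E = card ?C" using bij_betw_same_card by metis
  then show ?thesis using card_lists_length_eq[OF assms(2)] by simp
qed

lemma (in field) polynomial_zero_of_many_roots:
  assumes "p \<in> carrier (poly_ring R)" and "finite S" and "S \<subseteq> carrier R"
    and "\<And>x. x \<in> S \<Longrightarrow> eval p x = \<zero>" and "length p \<le> card S"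
  shows "p = []"
proof (rule ccontr)
  assume p: "p \<noteq> []"
  then have "S \<subseteq> set_mset (roots p)"
    using assms(3,4) roots_mem_iff_is_root[OF assms(1)] by (auto simp: is_root_def)
  then have "card S \<le> card (set_mset (roots p))" by (intro card_mono) auto
  also have "\<dots> \<le> size (roots p)" by (simp add: size_multiset_overloaded_eq sum_mono card_eq_sum Suc_le_eq del: sum_constant)
  also have "\<dots> \<le> length p - 1" using size_roots_le_degree[OF assms(1)] .
  finally show False using assms(5) p by (cases p) auto
qed

text \<open>
  The minimal polynomial of \<open>x\<close> divides \<open>X\<^sup>n - x\<^sup>n\<close>.
\<close>

lemma (in domain) degree_Irr_le_of_power_mem:
  assumes "subfield K R" and "x \<in> carrier R" and "n \<ge> 1" and "x [^] (n::nat) \<in> K"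
  shows "(algebraic over K) x" and "degree (Irr K x) \<le> n"
proof -
  define c where "c = \<ominus> (x [^] n)"
  have c: "c \<in> K" using assms(4) subringE(5)[OF subfieldE(1)[OF assms(1)]] by (simp add: c_def)
  define p where "p = monom \<one> (n - 1) @ [c]"
  have [simp]: "\<one> \<in> K" "\<zero> \<in> K"
    using subringE(2,3)[OF subfieldE(1)[OF assms(1)]] by auto
  have p: "p \<in> carrier (K[X])" "p \<noteq> []" and lp: "length p = Suc n"
    using c assms(3) by (auto simp: p_def monom_def univ_poly_def polynomial_def)
  have "eval p x = (eval (monom \<one> (n - 1)) x \<otimes> x) \<oplus> c"
    unfolding p_def using assms(2) c subfieldE(3)[OF assms(1)]
    by (intro eval_append_aux) (auto simp: monom_def)
  also have "eval (monom \<one> (n - 1)) x \<otimes> x = x [^] n"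
    using assms(2,3) by (cases n) (auto simp: eval_monom)
  finally have ev: "eval p x = \<zero>" using assms(2) by (simp add: c_def r_neg)
  show alg: "(algebraic over K) x"
    using algebraicI[OF p ev] .
  have "Irr K x pdivides p" using Irr_minimal[OF assms(1,2) alg p(1) ev] .
  then have "degree (Irr K x) \<le> degree p"
    using pdivides_imp_degree_le[OF subfieldE(1)[OF assms(1)] IrrE(1)[OF assms(1,2) alg] p]
    by simp
  then show "degree (Irr K x) \<le> n" using lp by simp
qed

text \<open>
  The difference of the two polynomials vanishes at \<open>x\<close> and has degree below that of the minimal
  polynomial of \<open>x\<close>, which divides it.
\<close>

lemma (in domain) eval_inj_below_degree_Irr:
  assumes K: "subfield K R" and x: "x \<in> carrier R" and alg: "(algebraic over K) x"
    and p: "p \<in> carrier (K[X])" "length p \<le> degree (Irr K x)"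
    and r: "r \<in> carrier (K[X])" "length r \<le> degree (Irr K x)"
    and eq: "eval p x = eval r x"
  shows "p = r"
proof -
  interpret UP: domain "K[X]" using univ_poly_is_domain[OF subfieldE(1)[OF K]] .
  interpret E: ring_hom_ring "K[X]" R "\<lambda>p. eval p x"
    using eval_ring_hom[OF subfieldE(1)[OF K] x] .
  define D where "D = p \<ominus>\<^bsub>K[X]\<^esub> r"
  have D: "D \<in> carrier (K[X])" using p(1) r(1) by (simp add: D_def)
  have "eval D x = eval p x \<oplus> \<ominus> eval r x"
    unfolding D_def UP.minus_eq using p(1) r(1) by (simp only: E.hom_add E.hom_a_inv UP.a_inv_closed)
  then have ev: "eval D x = \<zero>" using eq r(1) E.hom_closed by (simp add: r_neg)
  have len: "length D \<le> degree (Irr K x)"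
    using poly_add_length_le[of p "\<ominus>\<^bsub>K[X]\<^esub> r"] univ_poly_a_inv_length[OF subfieldE(1)[OF K] r(1)] p(2) r(2)
    unfolding D_def UP.minus_eq by (simp add: univ_poly_add)
  have "D = []"
  proof (rule ccontr)
    assume D0: "D \<noteq> []"
    have "degree (Irr K x) \<le> degree D"
      using pdivides_imp_degree_le[OF subfieldE(1)[OF K] IrrE(1)[OF K x alg] D D0]
        Irr_minimal[OF K x alg D ev] by simp
    then show False using len D0 by (cases D) auto
  qed
  then have "p \<ominus>\<^bsub>K[X]\<^esub> r = \<zero>\<^bsub>K[X]\<^esub>" by (simp add: D_def univ_poly_zero)
  then show ?thesis using p(1) r(1) by simp
qed

lemma (in ring) subring_nat_pow_closed:
  assumes "subring H R" and "x \<in> H"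
  shows "x [^] (n::nat) \<in> H"
  using assms subringE(3,6)[OF assms(1)] by (induction n) auto

lemma (in domain) pow_zero_imp_zero: "z \<in> carrier R \<Longrightarrow> z [^] (n::nat) = \<zero> \<Longrightarrow> z = \<zero>"
  by (induction n) (auto simp: integral_iff)

lemma (in ring) eval_in_simple_extension:
  assumes "K \<subseteq> carrier R" and "x \<in> carrier R" and "set l \<subseteq> K"
  shows "eval l x \<in> simple_extension K x"
  using assms(3)
proof (induction l rule: rev_induct)
  case (snoc c l)
  have "eval (l @ [c]) x = eval l x \<otimes> x \<oplus> c"
    using snoc.prems assms(1,2) by (intro eval_append_aux) auto
  then show ?case using snoc by (simp add: simple_extension.lin)
qed simp

text \<open>
  The leading terms of \<open>(X + 1)\<^sup>n\<close> and \<open>X\<^sup>n\<close> cancel. The induction uses that the next difference is \<open>X\<close>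
  times the present one, plus \<open>(X + 1)\<^sup>n\<close>.
\<close>

lemma (in field) length_shift_power_diff:
  "(([\<one>, \<one>] [^]\<^bsub>poly_ring R\<^esub> (n::nat)) \<ominus>\<^bsub>poly_ring R\<^esub> (X [^]\<^bsub>poly_ring R\<^esub> n)) \<in> carrier (poly_ring R)"
  "length (([\<one>, \<one>] [^]\<^bsub>poly_ring R\<^esub> (n::nat)) \<ominus>\<^bsub>poly_ring R\<^esub> (X [^]\<^bsub>poly_ring R\<^esub> n)) \<le> n"
proof -
  interpret UP: domain "poly_ring R" using univ_poly_is_domain[OF carrier_is_subring] .
  have Y: "[\<one>, \<one>] \<in> carrier (poly_ring R)" by (auto simp: univ_poly_def polynomial_def)
  have X: "X \<in> carrier (poly_ring R)" using var_closed(1)[OF carrier_is_subring] .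
  have YX: "[\<one>, \<one>] = X \<oplus>\<^bsub>poly_ring R\<^esub> \<one>\<^bsub>poly_ring R\<^esub>"
    by (simp add: univ_poly_add univ_poly_one var_def)
  let ?Y = "[\<one>, \<one>]"
  let ?D = "\<lambda>n::nat. (?Y [^]\<^bsub>poly_ring R\<^esub> n) \<ominus>\<^bsub>poly_ring R\<^esub> (X [^]\<^bsub>poly_ring R\<^esub> n)"
  show cl: "?D n \<in> carrier (poly_ring R)" for n using Y X by simp
  show "length (?D n) \<le> n"
  proof (induction n)
    case 0
    then show ?case using X Y by (simp add: UP.minus_eq UP.r_neg univ_poly_zero)
  next
    case (Suc n)
    let ?u = "?Y [^]\<^bsub>poly_ring R\<^esub> n" and ?v = "X [^]\<^bsub>poly_ring R\<^esub> n"
    have uv: "?u \<in> carrier (poly_ring R)" "?v \<in> carrier (poly_ring R)" using X Y by simp_all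
    have "?D (Suc n) = (?u \<otimes>\<^bsub>poly_ring R\<^esub> (X \<oplus>\<^bsub>poly_ring R\<^esub> \<one>\<^bsub>poly_ring R\<^esub>)) \<ominus>\<^bsub>poly_ring R\<^esub> (?v \<otimes>\<^bsub>poly_ring R\<^esub> X)"
      by (simp add: YX)
    also have "\<dots> = (?D n \<otimes>\<^bsub>poly_ring R\<^esub> X) \<oplus>\<^bsub>poly_ring R\<^esub> ?u"
      using uv X by algebra
    finally have eq: "?D (Suc n) = poly_add (?D n \<otimes>\<^bsub>poly_ring R\<^esub> X) ?u"
      by (simp add: univ_poly_add)
    have "length (?D n \<otimes>\<^bsub>poly_ring R\<^esub> X) \<le> Suc n"
      using poly_mult_var[OF carrier_is_subring cl[of n]] Suc by simp
    moreover have "length ?u \<le> Suc n"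
      using polynomial_pow_degree[OF Y, of n] by simp
    ultimately show ?case unfolding eq
      using poly_add_length_le[of "?D n \<otimes>\<^bsub>poly_ring R\<^esub> X" ?u] by simp
  qed
qed

section \<open>Products of linear polynomials\<close>

primrec (in ring) linear_product :: "(nat \<Rightarrow> 'a) \<Rightarrow> 'a \<Rightarrow> (nat \<Rightarrow> nat) \<Rightarrow> nat \<Rightarrow> 'a list" where
  "linear_product g b u 0 = \<one>\<^bsub>poly_ring R\<^esub>"
| "linear_product g b u (Suc n) =
     linear_product g b u n \<otimes>\<^bsub>poly_ring R\<^esub> ([g n, b] [^]\<^bsub>poly_ring R\<^esub> u n)"

lemma (in ring) poly_pow_eq: "p [^]\<^bsub>K[X]\<^esub> (n::nat) = p [^]\<^bsub>poly_ring R\<^esub> n"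
  unfolding nat_pow_def by (simp add: univ_poly_mult univ_poly_one)

text \<open>
  Multiplication of coefficient lists does not refer to the ring of coefficients, so the product formed
  over the whole of \<open>R\<close> is at the same time a product in \<open>K[X]\<close>.
\<close>

lemma (in domain) linear_product_closed:
  assumes "subring K R" and "\<And>t. t < n \<Longrightarrow> g t \<in> K - {\<zero>}" and "b \<in> K"
  shows "linear_product g b u n \<in> carrier (K[X])"
  using assms(2)
proof (induction n)
  interpret UP: domain "K[X]" using univ_poly_is_domain[OF assms(1)] .
  {
    case 0
    then show ?case using UP.one_closed by (simp add: univ_poly_one)
  next
    case (Suc n)
    have "[g n, b] \<in> carrier (K[X])"
      using Suc.prems[of n] assms(3) by (auto simp: univ_poly_def polynomial_def)
    then have "linear_product g b u n \<otimes>\<^bsub>K[X]\<^esub> ([g n, b] [^]\<^bsub>K[X]\<^esub> u n) \<in> carrier (K[X])"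
      using Suc by simp
    then show ?case by (simp add: poly_pow_eq[where K = K] univ_poly_mult)
  }
qed

context field
begin

lemma linear_poly_closed: "c \<in> carrier R - {\<zero>} \<Longrightarrow> b \<in> carrier R \<Longrightarrow> [c, b] \<in> carrier (poly_ring R)"
  by (auto simp: univ_poly_def polynomial_def)

lemma length_linear_product:
  assumes "\<And>t. t < n \<Longrightarrow> g t \<in> carrier R - {\<zero>}" and "b \<in> carrier R"
  shows "length (linear_product g b u n) = Suc (\<Sum>t<n. u t)"
  using assms(1)
proof (induction n)
  case 0
  then show ?case by (simp add: univ_poly_one)
next
  case (Suc n)
  have lin: "[g n, b] \<in> carrier (poly_ring R)" using Suc.prems assms(2) by (intro linear_poly_closed) auto
  interpret UP: domain "poly_ring R" using univ_poly_is_domain[OF carrier_is_subring] .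
  have P: "linear_product g b u n \<in> carrier (poly_ring R)"
    using Suc.prems assms(2) by (intro linear_product_closed carrier_is_subring) auto
  let ?r = "[g n, b] [^]\<^bsub>poly_ring R\<^esub> u n"
  have r: "?r \<in> carrier (poly_ring R)" "?r \<noteq> []" "degree ?r = u n"
    using lin polynomial_pow_not_zero[OF lin] polynomial_pow_degree[OF lin, of "u n"] by auto
  have len: "length (linear_product g b u n) = Suc (\<Sum>t<n. u t)" using Suc by simp
  have "degree (poly_mult (linear_product g b u n) ?r) = degree (linear_product g b u n) + degree ?r"
    using poly_mult_degree_eq[OF carrier_is_subring, of "linear_product g b u n" ?r] P r len
    by (auto simp: univ_poly_carrier)
  moreover have "poly_mult (linear_product g b u n) ?r \<noteq> []"
    using UP.integral[OF _ P r(1)] r(2) len by (auto simp: univ_poly_mult univ_poly_zero)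
  ultimately show ?case using len r(3)
    by (cases "poly_mult (linear_product g b u n) ?r") (auto simp: univ_poly_mult)
qed

lemma linear_power_roots:
  assumes c: "c \<in> carrier R - {\<zero>}" and b: "b \<in> carrier R"
  shows "roots ([c, b] [^]\<^bsub>poly_ring R\<^esub> (n::nat)) = replicate_mset n (\<ominus> (inv c \<otimes> b))"
proof (induction n)
  interpret UP: domain "poly_ring R" using univ_poly_is_domain[OF carrier_is_subring] .
  have lin: "[c, b] \<in> carrier (poly_ring R)" by (rule linear_poly_closed[OF c b])
  {
    case 0
    show ?case using degree_zero_imp_empty_roots[OF UP.one_closed] by (simp add: univ_poly_one)
  next
    case (Suc n)
    have "roots [c, b] = {#\<ominus> (inv c \<otimes> b)#}"
      using degree_one_imp_singleton_roots[OF lin] b c by (simp add: const_term_def)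
    then show ?case
      using associated_polynomials_imp_same_roots[OF UP.nat_pow_closed[OF lin]
          polynomial_pow_not_zero[OF lin] lin] Suc by simp
  }
qed

lemma linear_product_roots:
  assumes "\<And>t. t < n \<Longrightarrow> g t \<in> carrier R - {\<zero>}" and "b \<in> carrier R"
  shows "roots (linear_product g b u n) = (\<Sum>t<n. replicate_mset (u t) (\<ominus> (inv (g t) \<otimes> b)))"
  using assms(1)
proof (induction n)
  interpret UP: domain "poly_ring R" using univ_poly_is_domain[OF carrier_is_subring] .
  {
    case 0
    show ?case using degree_zero_imp_empty_roots[OF UP.one_closed] by (simp add: univ_poly_one)
  next
    case (Suc n)
    have lin: "[g n, b] \<in> carrier (poly_ring R)"
      using Suc.prems assms(2) by (intro linear_poly_closed) auto
    have P: "linear_product g b u n \<in> carrier (poly_ring R)"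
      using Suc.prems assms(2) by (intro linear_product_closed carrier_is_subring) auto
    have "linear_product g b u n \<noteq> []"
      using length_linear_product[of n g b u] Suc.prems assms(2) by fastforce
    then show ?case
      using associated_polynomials_imp_same_roots[OF P _ UP.nat_pow_closed[OF lin]
          polynomial_pow_not_zero[OF lin]] Suc linear_power_roots[of "g n" b] assms(2) by simp
  }
qed

lemma linear_product_eval:
  assumes "\<And>t. t < n \<Longrightarrow> g t \<in> carrier R - {\<zero>}" and "b \<in> carrier R"
    and x: "x \<in> carrier R" and y: "y \<in> carrier R"
    and "\<And>t. t < n \<Longrightarrow> g t \<otimes> x \<oplus> b = y [^] (w t :: nat)"
  shows "eval (linear_product g b u n) x = y [^] (\<Sum>t<n. w t * u t)"
  using assms(1,5)
proof (induction n)
  interpret UP: domain "poly_ring R" using univ_poly_is_domain[OF carrier_is_subring] .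
  interpret E: ring_hom_ring "poly_ring R" R "\<lambda>p. eval p x"
    using eval_ring_hom[OF carrier_is_subring x] .
  {
    case 0
    show ?case using E.hom_one by simp
  next
    case (Suc n)
    have lin: "[g n, b] \<in> carrier (poly_ring R)"
      using Suc.prems assms(2) by (intro linear_poly_closed) auto
    have P: "linear_product g b u n \<in> carrier (poly_ring R)"
      using Suc.prems assms(2) by (intro linear_product_closed carrier_is_subring) auto
    have gn: "g n \<in> carrier R" using Suc.prems(1)[of n] by simp
    have "eval [g n, b] x = g n \<otimes> x \<oplus> b" using gn assms(2) x by simp
    then have lin_ev: "eval [g n, b] x = y [^] w n" using Suc.prems(2)[of n] by simp
    have "eval (linear_product g b u (Suc n)) x
        = eval (linear_product g b u n) x \<otimes> (eval [g n, b] x) [^] u n"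
      unfolding linear_product.simps using P lin
      by (simp only: E.hom_mult E.hom_nat_pow UP.nat_pow_closed)
    also have "\<dots> = y [^] (\<Sum>t<n. w t * u t) \<otimes> (y [^] w n) [^] u n"
      using Suc lin_ev by simp
    also have "\<dots> = y [^] (\<Sum>t<Suc n. w t * u t)"
      using y by (simp only: nat_pow_pow nat_pow_mult sum.lessThan_Suc)
    finally show ?case .
  }
qed

text \<open>
  The exponent \<open>u j\<close> is the multiplicity of the root \<open>- b / g j\<close>. As \<open>b\<close> is not zero, distinct
  coefficients \<open>g t\<close> have distinct roots.
\<close>

lemma linear_product_exponents_unique:
  assumes g: "\<And>t. t < n \<Longrightarrow> g t \<in> carrier R - {\<zero>}" and b: "b \<in> carrier R - {\<zero>}"
    and inj: "inj_on g {..<n}"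
    and eq: "linear_product g b u n = linear_product g b v n" and j: "j < n"
  shows "u j = v j"
proof -
  define \<rho> where "\<rho> t = \<ominus> (inv (g t) \<otimes> b)" for t
  have \<rho>: "\<rho> t = \<rho> j \<longleftrightarrow> t = j" if t: "t < n" for t
  proof
    have units: "g t \<in> Units R" "g j \<in> Units R" using g t j field_Units by auto
    assume "\<rho> t = \<rho> j"
    then have "inv (g t) \<otimes> b = inv (g j) \<otimes> b"
      using units b unfolding \<rho>_def by (metis DiffD1 Units_inv_closed m_closed minus_minus)
    then have "inv (g t) = inv (g j)" using units b m_rcancel by simp
    then have "g t = g j" using units by (metis Units_inv_inv)
    then show "t = j" using inj t j by (auto dest: inj_onD)
  qed simp
  have "count (roots (linear_product g b z n)) (\<rho> j) = z j" for z
  proof -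
    have "count (roots (linear_product g b z n)) (\<rho> j) = (\<Sum>t<n. if \<rho> t = \<rho> j then z t else 0)"
      using linear_product_roots[of n g b z] g b
      by (simp add: count_sum \<rho>_def eq_commute)
    also have "\<dots> = (\<Sum>t<n. if t = j then z t else 0)"
      using \<rho> by (intro sum.cong) auto
    also have "\<dots> = z j" using j by simp
    finally show ?thesis .
  qed
  from this[of u] this[of v] show ?thesis using eq by simp
qed

lemma card_le_ord_of_powers:
  assumes "finite (carrier R)" and y: "y \<in> carrier R - {\<zero>}"
    and "inj_on (\<lambda>l. y [^] (w l :: nat)) U"
  shows "card U \<le> group.ord (Multiplicative_Group.mult_of R) y"
proof -
  interpret G: group "Multiplicative_Group.mult_of R" by (rule field_mult_group)
  have pow: "y [^]\<^bsub>Multiplicative_Group.mult_of R\<^esub> (i::nat) = y [^] i" for i by (simp add: nat_pow_def)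
  have fin: "finite (carrier (Multiplicative_Group.mult_of R))"
    and yG: "y \<in> carrier (Multiplicative_Group.mult_of R)" using assms by auto
  have ord: "G.ord y \<ge> 1" by (rule G.ord_ge_1[OF fin yG])
  have "card U = card ((\<lambda>l. y [^] w l) ` U)" using assms(3) by (simp add: card_image)
  also have "\<dots> \<le> card ((\<lambda>i. y [^] i) ` {0..G.ord y - 1})"
  proof (rule card_mono)
    show "(\<lambda>l. y [^] w l) ` U \<subseteq> (\<lambda>i. y [^] i) ` {0..G.ord y - 1}"
    proof
      fix z assume "z \<in> (\<lambda>l. y [^] w l) ` U"
      then have "z \<in> {y [^] i |i. i \<in> (UNIV :: nat set)}" by auto
      then show "z \<in> (\<lambda>i. y [^] i) ` {0..G.ord y - 1}"
        using G.ord_elems[OF fin yG] unfolding pow by blast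
    qed
  qed simp
  also have "\<dots> \<le> card {0..G.ord y - 1}" by (rule card_image_le) simp
  also have "\<dots> = G.ord y" using ord by simp
  finally show ?thesis .
qed

end

section \<open>The Frobenius map of a finite extension\<close>

locale finite_field_extension = field R for R (structure) +
  fixes F :: "'a set"
  assumes finite_carrier: "finite (carrier R)"
    and subfield_base: "subfield F R"
begin

abbreviation "q \<equiv> card F"

lemma base_subring: "subring F R" and base_incl: "F \<subseteq> carrier R"
  and finite_base: "finite F"
  using subfieldE(1,3)[OF subfield_base] finite_carrier finite_subset by auto

lemma base_pow_card: "c \<in> F \<Longrightarrow> c [^] q = c"
proof -
  assume c: "c \<in> F"
  interpret B: field "R \<lparr>carrier := F\<rparr>" using subfield_iff(2)[OF subfield_base] .
  have fin: "finite (carrier (R \<lparr>carrier := F\<rparr>))" using finite_base by simp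
  interpret G: group "Multiplicative_Group.mult_of (R \<lparr>carrier := F\<rparr>)" by (rule B.field_mult_group)
  have pos: "q \<noteq> 0" using c finite_base by auto
  show ?thesis
  proof (cases "c = \<zero>")
    case True
    then show ?thesis using pos by (simp add: nat_pow_zero)
  next
    case False
    then have "c [^]\<^bsub>Multiplicative_Group.mult_of (R \<lparr>carrier := F\<rparr>)\<^esub> order (Multiplicative_Group.mult_of (R \<lparr>carrier := F\<rparr>)) = \<one>"
      using G.pow_order_eq_1[of c] c by simp
    moreover have "order (Multiplicative_Group.mult_of (R \<lparr>carrier := F\<rparr>)) = q - 1"
      using B.order_mult_of[OF fin] by (simp add: order_def)
    ultimately have "c [^] (q - 1) = \<one>"
      by (simp add: nat_pow_def)
    then show ?thesis using pos c base_incl by (cases q) auto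
  qed
qed

lemma card_base_ge_2: "q \<ge> 2"
proof -
  have "{\<zero>, \<one>} \<subseteq> F" using subringE(2,3)[OF base_subring] by simp
  from card_mono[OF finite_base this] show ?thesis by simp
qed

text \<open>
  The polynomial \<open>(X + 1)\<^sup>q - X\<^sup>q - 1\<close> has degree less than \<open>q\<close>, but every element of \<open>F\<close> is a root of
  it, because \<open>c\<^sup>q = c\<close> on \<open>F\<close>. Hence it is the zero polynomial.
\<close>

lemma Frobenius_add_one:
  assumes x: "x \<in> carrier R"
  shows "(x \<oplus> \<one>) [^] q = x [^] q \<oplus> \<one>"
proof -
  interpret UP: domain "poly_ring R" using univ_poly_is_domain[OF carrier_is_subring] .
  define D where "D = ([\<one>, \<one>] [^]\<^bsub>poly_ring R\<^esub> q) \<ominus>\<^bsub>poly_ring R\<^esub> (X [^]\<^bsub>poly_ring R\<^esub> q)"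
  define P where "P = D \<ominus>\<^bsub>poly_ring R\<^esub> \<one>\<^bsub>poly_ring R\<^esub>"
  have D: "D \<in> carrier (poly_ring R)" "length D \<le> q"
    unfolding D_def by (rule length_shift_power_diff)+
  have Y: "[\<one>, \<one>] \<in> carrier (poly_ring R)" by (auto simp: univ_poly_def polynomial_def)
  have X: "X \<in> carrier (poly_ring R)" using var_closed(1)[OF carrier_is_subring] .
  have P: "P \<in> carrier (poly_ring R)" using D by (simp add: P_def)
  have ev: "eval P y = ((y \<oplus> \<one>) [^] q \<ominus> y [^] q) \<ominus> \<one>" if y: "y \<in> carrier R" for y
  proof -
    interpret E: ring_hom_ring "poly_ring R" R "\<lambda>p. eval p y"
      using eval_ring_hom[OF carrier_is_subring y] .
    have e1: "eval [\<one>, \<one>] y = y \<oplus> \<one>" using y by simp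
    have e2: "eval X y = y" using eval_var[OF y] .
    show ?thesis
      unfolding P_def D_def using X Y y
      by (simp only: E.hom_nat_pow E.hom_one UP.nat_pow_closed UP.minus_closed UP.one_closed
          UP.minus_eq E.hom_add E.hom_a_inv UP.a_inv_closed UP.a_closed e1 e2 minus_eq)
  qed
  have "length P \<le> q"
  proof -
    have "length \<one>\<^bsub>poly_ring R\<^esub> \<le> q" using card_base_ge_2 by (simp add: univ_poly_one)
    then show ?thesis
      using poly_add_length_le[of D "\<ominus>\<^bsub>poly_ring R\<^esub> \<one>\<^bsub>poly_ring R\<^esub>"] D(2)
        univ_poly_a_inv_length[OF carrier_is_subring UP.one_closed]
      unfolding P_def UP.minus_eq by (simp add: univ_poly_add)
  qed
  moreover have "eval P c = \<zero>" if c: "c \<in> F" for c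
  proof -
    have c': "c \<in> carrier R" using c base_incl by blast
    have "c \<oplus> \<one> \<in> F" using c subringE(3,7)[OF base_subring] by simp
    then have "eval P c = ((c \<oplus> \<one>) \<ominus> c) \<ominus> \<one>"
      using ev[OF c'] c base_pow_card by simp
    also have "\<dots> = \<zero>" using c' by algebra
    finally show ?thesis .
  qed
  ultimately have "P = []"
    by (intro polynomial_zero_of_many_roots[OF P finite_base base_incl])
  then have "((x \<oplus> \<one>) [^] q \<ominus> x [^] q) \<ominus> \<one> = \<zero>" using ev[OF x] by simp
  moreover have "a = b \<oplus> \<one>" if "a \<in> carrier R" "b \<in> carrier R" "(a \<ominus> b) \<ominus> \<one> = \<zero>" for a b
  proof -
    have "a = ((a \<ominus> b) \<ominus> \<one>) \<oplus> (b \<oplus> \<one>)" using that(1,2) by algebra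
    then show ?thesis using that by simp
  qed
  ultimately show ?thesis using x by simp
qed

text \<open>
  The general case follows from the previous one by homogeneity, after division by \<open>y\<close>.
\<close>

lemma Frobenius_add:
  assumes x: "x \<in> carrier R" and y: "y \<in> carrier R"
  shows "(x \<oplus> y) [^] q = x [^] q \<oplus> y [^] q"
proof (cases "y = \<zero>")
  case True
  then show ?thesis using x card_base_ge_2 by (simp add: nat_pow_zero)
next
  case False
  then have u: "y \<in> Units R" using y field_Units by simp
  define z where "z = inv y \<otimes> x"
  have z: "z \<in> carrier R" "x = y \<otimes> z"
    using u x y by (simp_all add: z_def m_assoc[symmetric])
  have "(x \<oplus> y) [^] q = (y \<otimes> (z \<oplus> \<one>)) [^] q" using z y by (simp add: r_distr)
  also have "\<dots> = y [^] q \<otimes> (z [^] q \<oplus> \<one>)"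
    using z(1) y by (simp add: nat_pow_distrib Frobenius_add_one)
  also have "\<dots> = x [^] q \<oplus> y [^] q"
    using z y by (simp add: r_distr nat_pow_distrib)
  finally show ?thesis .
qed

lemma iterated_Frobenius_add:
  assumes "x \<in> carrier R" and "y \<in> carrier R"
  shows "(x \<oplus> y) [^] (q ^ k) = x [^] (q ^ k) \<oplus> y [^] (q ^ k)"
proof (induction k)
  case (Suc k)
  have *: "z [^] (q ^ Suc k) = (z [^] (q ^ k)) [^] q" if "z \<in> carrier R" for z
    using that by (simp add: nat_pow_pow mult.commute)
  show ?case using assms by (simp add: * Suc Frobenius_add del: power_Suc)
qed (use assms in simp)

lemma base_pow_card_power: "c \<in> F \<Longrightarrow> c [^] (q ^ k) = c"
proof (induction k)
  case (Suc k)
  have "c [^] (q ^ Suc k) = (c [^] (q ^ k)) [^] q"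
    using Suc.prems base_incl by (subst nat_pow_pow) (auto simp: mult.commute)
  then show ?case using Suc base_pow_card by simp
qed (use base_incl in auto)

lemma iterated_Frobenius_inj:
  assumes x: "x \<in> carrier R" and y: "y \<in> carrier R" and eq: "x [^] (q ^ k) = y [^] (q ^ k)"
  shows "x = y"
proof -
  have pos: "q ^ k \<noteq> 0" using card_base_ge_2 by simp
  have "x [^] (q ^ k) = (x \<ominus> y) [^] (q ^ k) \<oplus> y [^] (q ^ k)"
  proof -
    have "x = (x \<ominus> y) \<oplus> y" using x y by algebra
    then show ?thesis using iterated_Frobenius_add[of "x \<ominus> y" y k] x y by simp
  qed
  then have "(x \<ominus> y) [^] (q ^ k) = \<zero>"
    using eq x y by (metis add.r_cancel_one' minus_closed nat_pow_closed a_comm)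
  then have "x \<ominus> y = \<zero>" using x y by (metis minus_closed pow_zero_imp_zero)
  then show ?thesis using x y by simp
qed

text \<open>
  In a finite field every non-zero element has a power equal to \<open>1\<close>.
\<close>

lemma algebraic_over_subfield:
  assumes K: "subfield K R" and x: "x \<in> carrier R"
  shows "(algebraic over K) x"
proof -
  have K': "\<zero> \<in> K" "\<one> \<in> K" using subringE(2,3)[OF subfieldE(1)[OF K]] by auto
  show ?thesis
  proof (cases "x = \<zero>")
    case True
    then show ?thesis using degree_Irr_le_of_power_mem(1)[OF K x, of 1] K' x by simp
  next
    case False
    interpret G: group "Multiplicative_Group.mult_of R" by (rule field_mult_group)
    have x': "x \<in> carrier (Multiplicative_Group.mult_of R)" using x False by simp
    have "G.ord x \<ge> 1"
      using G.ord_ge_1[OF _ x'] finite_carrier by simp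
    moreover have "x [^] G.ord x \<in> K"
      using G.pow_ord_eq_1[OF x'] K' by (simp add: nat_pow_def)
    ultimately show ?thesis using degree_Irr_le_of_power_mem(1)[OF K x] by blast
  qed
qed

lemma card_simple_extension:
  assumes "x \<in> carrier R"
  shows "card (simple_extension F x) = q ^ degree (Irr F x)"
  using card_of_dimension[OF subfield_base finite_base
      dimension_simple_extension[OF subfield_base assms algebraic_over_subfield[OF subfield_base assms]]] .

lemma subring_fixed_by_iterated_Frobenius:
  "subring {x \<in> carrier R. x [^] (q ^ k) = x} R"
proof (rule subringI)
  have pos: "q ^ k \<noteq> 0" using card_base_ge_2 by simp
  fix h assume h: "h \<in> {x \<in> carrier R. x [^] (q ^ k) = x}"
  then have hc: "h \<in> carrier R" and hf: "h [^] (q ^ k) = h" by auto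
  have "\<zero> = (h \<oplus> \<ominus> h) [^] (q ^ k)" using hc pos by (simp add: r_neg nat_pow_zero)
  also have "\<dots> = h \<oplus> (\<ominus> h) [^] (q ^ k)" using hc hf by (simp add: iterated_Frobenius_add)
  finally have "(\<ominus> h) [^] (q ^ k) = \<ominus> h"
    using hc by (metis a_inv_closed minus_equality nat_pow_closed a_comm)
  then show "\<ominus> h \<in> {x \<in> carrier R. x [^] (q ^ k) = x}" using hc by simp
qed (auto simp: nat_pow_distrib iterated_Frobenius_add)

text \<open>
  The fixed points of the \<open>k\<close>-th iterate form a subring that contains \<open>F\<close> and \<open>x\<close>, hence \<open>F(x)\<close>,
  and as roots of \<open>X\<^bsup>N\<^esup> - X\<close> with \<open>N = q\<^sup>k\<close> there are at most \<open>q\<^sup>k\<close> of them, whereas \<open>F(x)\<close> has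
  \<open>q\<close> to the power \<open>degree (Irr F x)\<close> elements.
\<close>

lemma degree_le_of_Frobenius_fixed:
  assumes x: "x \<in> carrier R" and k: "k \<ge> 1" and fixed: "x [^] (q ^ k) = x"
  shows "degree (Irr F x) \<le> k"
proof -
  let ?E = "{x \<in> carrier R. x [^] (q ^ k) = x}"
  have Q: "q ^ k \<ge> 2" using card_base_ge_2 k self_le_power[of q k] by linarith
  have "simple_extension F x \<subseteq> ?E"
    using base_incl base_pow_card_power x fixed
    by (intro simple_extension_subring_incl subring_fixed_by_iterated_Frobenius) auto
  also have "?E \<subseteq> insert \<zero> {x \<in> carrier R. x [^] (q ^ k - 1) = \<one>}"
  proof
    fix y assume "y \<in> ?E"
    then have y: "y \<in> carrier R" "y [^] (q ^ k) = y" by auto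
    have "y [^] (q ^ k) = y [^] (q ^ k - 1) \<otimes> y" using Q by (cases "q ^ k") auto
    then have "y = \<zero> \<or> y [^] (q ^ k - 1) = \<one>"
      using y by (metis l_one m_rcancel nat_pow_closed one_closed)
    then show "y \<in> insert \<zero> {x \<in> carrier R. x [^] (q ^ k - 1) = \<one>}" using y by auto
  qed
  finally have "card (simple_extension F x) \<le> card (insert \<zero> {x \<in> carrier R. x [^] (q ^ k - 1) = \<one>})"
    using finite_carrier by (intro card_mono) auto
  also have "\<dots> \<le> Suc (card {x \<in> carrier R. x [^] (q ^ k - 1) = \<one>})"
    using finite_carrier by (simp add: card_insert_if)
  also have "\<dots> \<le> Suc (q ^ k - 1)"
    using num_roots_le_deg[OF finite_carrier, of "q ^ k - 1"] Q by simp
  also have "\<dots> = q ^ k" using Q by simp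
  finally have "q ^ degree (Irr F x) \<le> q ^ k" using card_simple_extension[OF x] by simp
  then show ?thesis using card_base_ge_2 by (simp add: power_le_imp_le_exp)
qed

end

section \<open>Extensions generated by a root of an element of the base\<close>

locale radical_extension = finite_field_extension +
  fixes \<theta> :: 'a and m :: nat
  assumes root_closed: "\<theta> \<in> carrier R"
    and root_power: "\<theta> [^] m \<in> F"
    and generated: "simple_extension F \<theta> = carrier R"
    and degree_root: "degree (Irr F \<theta>) = m"
    and m_pos: "m \<ge> 1"
begin

text \<open>
  Each of the two steps of the tower \<open>F \<subseteq> F(\<theta>\<^sup>M) \<subseteq> F(\<theta>)\<close> is generated by a root of a binomial, which
  bounds its degree by \<open>k\<close> and \<open>M\<close> respectively. The degrees multiply to \<open>m = M * k\<close>, so both bounds are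
  attained.
\<close>

lemma tower_degrees:
  assumes "M * k = m"
  shows "degree (Irr F (\<theta> [^] M)) = k"
    and "degree (Irr (simple_extension F (\<theta> [^] M)) \<theta>) = M"
    and "subfield (simple_extension F (\<theta> [^] M)) R"
proof -
  have pos: "M \<ge> 1" "k \<ge> 1" using assms m_pos by (auto simp: Suc_le_eq intro!: gr0I)
  define y where "y = \<theta> [^] M"
  define L where "L = simple_extension F y"
  have y: "y \<in> carrier R" using root_closed by (simp add: y_def)
  have algy: "(algebraic over F) y" by (rule algebraic_over_subfield[OF subfield_base y])
  have L: "subfield L R"
    unfolding L_def using simple_extension_is_subfield[OF subfield_base y] algy by simp
  have algt: "(algebraic over L) \<theta>" by (rule algebraic_over_subfield[OF L root_closed])
  have FL: "F \<subseteq> L" unfolding L_def by (rule simple_extension_incl[OF base_incl y])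
  have gen: "simple_extension L \<theta> = carrier R"
    using mono_simple_extension[OF FL, of \<theta>] generated
      simple_extension_in_carrier[OF subfieldE(3)[OF L] root_closed] by auto
  have "y [^] k \<in> F" using root_power assms root_closed by (simp add: y_def nat_pow_pow)
  then have le1: "degree (Irr F y) \<le> k"
    using degree_Irr_le_of_power_mem(2)[OF subfield_base y pos(2)] by simp
  have "y \<in> L" unfolding L_def by (rule simple_extension_mem[OF base_subring y])
  then have le2: "degree (Irr L \<theta>) \<le> M"
    using degree_Irr_le_of_power_mem(2)[OF L root_closed pos(1)] by (simp add: y_def)
  have "finite_dimension F L"
    unfolding L_def using finite_dimension_simple_extension[OF subfield_base y] algy by simp
  moreover have "finite_dimension L (simple_extension L \<theta>)"
    using finite_dimension_simple_extension[OF L root_closed] algt by simp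
  ultimately have "(dim over F) (carrier R) = (dim over F) L * (dim over L) (carrier R)"
    using telescopic_base_dim(2)[OF subfield_base L] gen by simp
  moreover have "(dim over F) (carrier R) = m"
    using simple_extension_dim[OF subfield_base root_closed
        algebraic_over_subfield[OF subfield_base root_closed]] generated degree_root by simp
  moreover have "(dim over F) L = degree (Irr F y)"
    unfolding L_def by (rule simple_extension_dim[OF subfield_base y algy])
  moreover have "(dim over L) (carrier R) = degree (Irr L \<theta>)"
    using simple_extension_dim[OF L root_closed algt] gen by simp
  ultimately have prod: "degree (Irr F y) * degree (Irr L \<theta>) = k * M"
    using assms by (simp add: mult.commute)
  have "degree (Irr F y) = k"
  proof (rule antisym[OF le1], rule ccontr)
    assume "\<not> k \<le> degree (Irr F y)"
    then have lt: "degree (Irr F y) < k" by simp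
    have "degree (Irr F y) * degree (Irr L \<theta>) \<le> degree (Irr F y) * M"
      using le2 by (rule mult_le_mono2)
    also have "\<dots> < k * M" using lt pos by simp
    finally show False using prod by linarith
  qed
  moreover from this prod have "degree (Irr L \<theta>) = M" using pos by simp
  ultimately show "degree (Irr F (\<theta> [^] M)) = k"
    "degree (Irr (simple_extension F (\<theta> [^] M)) \<theta>) = M"
    "subfield (simple_extension F (\<theta> [^] M)) R"
    using L by (simp_all add: L_def y_def)
qed

lemma root_not_zero: "m \<ge> 2 \<Longrightarrow> \<theta> \<noteq> \<zero>"
  using degree_le_of_Frobenius_fixed[OF root_closed, of 1] degree_root card_base_ge_2
  by (auto simp: nat_pow_zero)

text \<open>
  By injectivity of the Frobenius map, a coincidence \<open>i < j\<close> would make \<open>\<theta>\<close> a fixed point of its iterate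
  \<open>j - i\<close>, and hence of degree at most \<open>j - i < m\<close>.
\<close>

lemma conjugates_distinct:
  assumes "i < m" "j < m" and "\<theta> [^] (q ^ i) = \<theta> [^] (q ^ j)"
  shows "i = j"
proof -
  have *: "\<not> i < j" if "i < m" "j < m" "\<theta> [^] (q ^ i) = \<theta> [^] (q ^ j)" for i j
  proof
    assume ij: "i < j"
    have "q ^ j = q ^ (j - i) * q ^ i" using ij by (simp flip: power_add)
    then have "(\<theta> [^] (q ^ (j - i))) [^] (q ^ i) = \<theta> [^] (q ^ i)"
      using that root_closed by (simp add: nat_pow_pow)
    then have "\<theta> [^] (q ^ (j - i)) = \<theta>"
      by (rule iterated_Frobenius_inj[OF nat_pow_closed[OF root_closed] root_closed])
    then have "m \<le> j - i"
      using degree_le_of_Frobenius_fixed[OF root_closed, of "j - i"] degree_root ij by simp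
    then show False using that(2) ij by linarith
  qed
  show ?thesis using *[of i j] *[of j i] assms by (metis linorder_neqE_nat)
qed

text \<open>
  Let \<open>y = \<theta>\<^sup>M\<close> with \<open>M = m div l\<close>. It has degree \<open>l\<close> over \<open>F\<close> and \<open>y\<^sup>l \<in> F\<close>. If \<open>l\<close> divides \<open>q\<close>,
  then already \<open>y\<^sup>q\<close>, a power of \<open>y\<^sup>l\<close>, lies in \<open>F\<close>, and injectivity of the Frobenius map makes \<open>y\<close> a
  fixed point, of degree at most \<open>1\<close>. If \<open>l\<close> divides neither \<open>q\<close> nor \<open>q - 1\<close>, the order of \<open>y\<close> divides
  \<open>l * (q - 1)\<close>, which by Fermat's theorem divides \<open>q ^ (l - 1) - 1\<close>; then \<open>y\<close> is fixed by the iterate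
  \<open>l - 1\<close> of the Frobenius map and has degree at most \<open>l - 1\<close>.
\<close>

lemma prime_divisor_of_degree_dvd:
  assumes l: "Factorial_Ring.prime l" "l dvd m"
  shows "l dvd q - 1"
proof (rule ccontr)
  assume nd: "\<not> l dvd q - 1"
  obtain M where M: "M * l = m" using l(2) by (metis dvdE mult.commute)
  have l2: "l \<ge> 2" using prime_ge_2_nat[OF l(1)] .
  have m2: "m \<ge> 2" using dvd_imp_le[OF l(2)] m_pos l2 by linarith
  define y where "y = \<theta> [^] M"
  have y: "y \<in> carrier R" using root_closed by (simp add: y_def)
  have degy: "degree (Irr F y) = l" unfolding y_def by (rule tower_degrees(1)[OF M])
  have yl: "y [^] l \<in> F" using root_power root_closed M by (simp add: y_def nat_pow_pow)
  have y0: "y \<noteq> \<zero>"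
    using root_not_zero[OF m2] root_closed pow_zero_imp_zero by (auto simp: y_def)
  have q2: "q \<ge> 2" by (rule card_base_ge_2)
  show False
  proof (cases "l dvd q")
    case True
    then obtain w where w: "q = l * w" by (auto elim: dvdE)
    have "(y [^] l) [^] w \<in> F"
      by (rule subring_nat_pow_closed[OF base_subring yl])
    then have "y [^] q \<in> F" using w y by (simp add: nat_pow_pow)
    then have "(y [^] q) [^] q = y [^] q" by (rule base_pow_card)
    then have "y [^] q = y" using iterated_Frobenius_inj[of "y [^] q" y 1] y by simp
    then have "degree (Irr F y) \<le> 1" using degree_le_of_Frobenius_fixed[OF y, of 1] by simp
    then show False using degy l2 by simp
  next
    case False
    define N where "N = q ^ (l - 1)"
    have N: "N \<ge> 1" using q2 by (simp add: N_def)
    have "l * (q - 1) dvd N - 1"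
      unfolding N_def using prime_mult_pred_dvd_power_pred[OF l(1) _ False nd] q2 by simp
    then obtain w where w: "N - 1 = l * (q - 1) * w" by (rule dvdE)
    have "(y [^] l) [^] q = y [^] l" by (rule base_pow_card[OF yl])
    moreover have "q = Suc (q - 1)" using q2 by simp
    ultimately have "(y [^] l) [^] Suc (q - 1) = y [^] l" by metis
    then have "(y [^] l) [^] (q - 1) \<otimes> (y [^] l) = \<one> \<otimes> (y [^] l)"
      using y by simp
    moreover have "y [^] l \<noteq> \<zero>" using y0 pow_zero_imp_zero[OF y] by blast
    ultimately have "(y [^] l) [^] (q - 1) = \<one>"
      using y m_rcancel by (metis nat_pow_closed one_closed)
    then have "((y [^] l) [^] (q - 1)) [^] w = \<one>" by simp
    then have "y [^] (N - 1) = \<one>" unfolding w using y by (simp only: nat_pow_pow nat_pow_closed)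
    moreover have "N = Suc (N - 1)" using N by simp
    ultimately have "y [^] N = y" using y by (metis l_one nat_pow_Suc)
    then have "y [^] (q ^ (l - 1)) = y" by (simp add: N_def)
    then have "degree (Irr F y) \<le> l - 1"
      using degree_le_of_Frobenius_fixed[OF y, of "l - 1"] l2 by simp
    then show False using degy l2 by simp
  qed
qed

lemma root_plus_const_conjugate:
  assumes "b \<in> F"
  shows "(\<theta> \<oplus> b) [^] (q ^ i) = \<theta> [^] (q ^ i) \<oplus> b"
  using iterated_Frobenius_add[OF root_closed, of b i] base_pow_card_power[OF assms] assms base_incl
  by auto

text \<open>
  The condition \<open>M dvd q ^ e - 1\<close> puts the quotients of \<open>\<theta>\<close> and its conjugates by multiples of \<open>e\<close> into
  \<open>L = F(\<theta>\<^sup>M)\<close>, and \<open>e * B \<le> m\<close> makes the first \<open>B\<close> of these conjugates distinct.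
\<close>

lemma ord_root_plus_const_ge_binomial:
  assumes m2: "m \<ge> 2" and Mk: "M * k = m" and e: "M dvd q ^ e - 1" "e \<ge> 1" and eB: "e * B \<le> m"
    and b: "b \<in> F" "b \<noteq> \<zero>"
  shows "(M - 1 + B) choose B \<le> group.ord (Multiplicative_Group.mult_of R) (\<theta> \<oplus> b)"
proof -
  define L where "L = simple_extension F (\<theta> [^] M)"
  note tower = tower_degrees[OF Mk, folded L_def]
  have M1: "M \<ge> 1" using Mk m2 by (cases M) auto
  have bc: "b \<in> carrier R" using b base_incl by blast
  have L: "subring L R" by (rule subfieldE(1)[OF tower(3)])
  have yL: "\<theta> [^] M \<in> L"
    unfolding L_def using root_closed by (intro simple_extension_mem[OF base_subring]) auto
  have FL: "F \<subseteq> L"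
    unfolding L_def using root_closed by (intro simple_extension_incl[OF base_incl]) auto
  have algt: "(algebraic over L) \<theta>" by (rule algebraic_over_subfield[OF tower(3) root_closed])
  define y where "y = \<theta> \<oplus> b"
  have y: "y \<in> carrier R" using root_closed bc by (simp add: y_def)
  have "y \<noteq> \<zero>"
  proof
    assume "y = \<zero>"
    then have "\<theta> = \<ominus> b" using root_closed bc by (simp add: y_def minus_equality)
    then have "\<theta> \<in> F" using b(1) subringE(5)[OF base_subring] by simp
    then have "\<theta> [^] (q ^ 1) = \<theta>" using base_pow_card by simp
    then have "degree (Irr F \<theta>) \<le> 1"
      by (rule degree_le_of_Frobenius_fixed[OF root_closed order_refl])
    then show False using degree_root m2 by linarith
  qed
  define g where "g t = \<theta> [^] (q ^ (e * t) - 1)" for t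
  have gc: "g t \<in> carrier R" for t using root_closed by (simp add: g_def)
  have gtheta: "g t \<otimes> \<theta> = \<theta> [^] (q ^ (e * t))" for t
  proof -
    have "Suc (q ^ (e * t) - 1) = q ^ (e * t)" using card_base_ge_2 by simp
    then show ?thesis unfolding g_def by (metis nat_pow_Suc)
  qed
  have g0: "g t \<noteq> \<zero>" for t
    using root_not_zero[OF m2] pow_zero_imp_zero[OF root_closed] unfolding g_def by blast
  have gL: "g t \<in> L" for t
  proof -
    have "M dvd q ^ (e * t) - 1"
      using dvd_pred_power[of "q ^ e" M t] e card_base_ge_2 by (simp add: power_mult)
    then obtain w where w: "q ^ (e * t) - 1 = M * w" by (rule dvdE)
    have "g t = (\<theta> [^] M) [^] w" unfolding g_def w using root_closed by (simp add: nat_pow_pow)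
    then show ?thesis using subring_nat_pow_closed[OF L yL] by simp
  qed
  have ginj: "inj_on g {..<B}"
  proof (rule inj_onI)
    fix s t assume st: "s \<in> {..<B}" "t \<in> {..<B}" "g s = g t"
    have "\<theta> [^] (q ^ (e * s)) = \<theta> [^] (q ^ (e * t))"
      using gtheta[of s] gtheta[of t] st(3) by simp
    moreover have "e * r < m" if "r < B" for r
      using mult_less_mono2[OF that, of e] e(2) eB by linarith
    ultimately have "e * s = e * t" using st(1,2) conjugates_distinct[of "e * s" "e * t"] by auto
    then show "s = t" using e(2) by simp
  qed
  define w where "w l = (\<Sum>t<B. q ^ (e * t) * l ! t)" for l :: "nat list"
  \<comment> \<open>The last entry is slack: it turns the inequality "the exponents have sum at most \<open>M - 1\<close>" into an
    equation, which is the form that has a closed formula for the number of solutions.\<close>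
  define U where "U = {l :: nat list. length l = Suc B \<and> sum_list l = M - 1}"
  have sumU: "(\<Sum>t<B. l ! t) + l ! B = M - 1" if "l \<in> U" for l
    using that sum_list_sum_nth[of l] by (auto simp: U_def atLeast0LessThan)
  have ev: "eval (linear_product g b ((!) l) B) \<theta> = y [^] w l" for l
    unfolding w_def using gc g0 gtheta root_plus_const_conjugate[OF b(1)]
    by (intro linear_product_eval) (auto simp: bc root_closed y y_def)
  have PL: "linear_product g b ((!) l) B \<in> carrier (L[X])" for l
    using gL g0 FL b by (intro linear_product_closed[OF L]) auto
  have len: "length (linear_product g b ((!) l) B) \<le> degree (Irr L \<theta>)" if "l \<in> U" for l
    using length_linear_product[of B g b "(!) l"] gc g0 bc sumU[OF that] M1 tower(2) by simp
  have "inj_on (\<lambda>l. y [^] w l) U"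
  proof (rule inj_onI)
    fix l l' assume l: "l \<in> U" "l' \<in> U" and eq: "y [^] w l = y [^] w l'"
    have "linear_product g b ((!) l) B = linear_product g b ((!) l') B"
      using eval_inj_below_degree_Irr[OF tower(3) root_closed algt PL len[OF l(1)] PL len[OF l(2)]]
        eq by (simp add: ev)
    then have nth: "l ! t = l' ! t" if "t < B" for t
      using linear_product_exponents_unique[of B g b "(!) l" "(!) l'" t] gc g0 b(2) bc ginj that by simp
    then have "(\<Sum>t<B. l ! t) = (\<Sum>t<B. l' ! t)" by simp
    then have "l ! B = l' ! B" using sumU[OF l(1)] sumU[OF l(2)] by simp
    with nth have "l ! t = l' ! t" if "t < Suc B" for t using that by (cases "t = B") auto
    then show "l = l'" using l by (intro nth_equalityI) (auto simp: U_def)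
  qed
  then have "card U \<le> group.ord (Multiplicative_Group.mult_of R) y"
    using y \<open>y \<noteq> \<zero>\<close> by (intro card_le_ord_of_powers[OF finite_carrier]) auto
  moreover have "card U = (M - 1 + B) choose B"
    unfolding U_def using card_length_sum_list[of "Suc B" "M - 1"] binomial_symmetric[of B "M - 1 + B"]
    by simp
  ultimately show ?thesis by (simp add: y_def)
qed

theorem ord_root_plus_const_ge:
  assumes nd: "\<not> m dvd q - 1" and b: "b \<in> F" "b \<noteq> \<zero>"
  shows "2 powr sqrt (2 * real m) \<le> real (group.ord (Multiplicative_Group.mult_of R) (\<theta> \<oplus> b))"
proof -
  define d where "d = gcd m (q - 1)"
  define s where "s = m div d"
  have m: "m = d * s" by (simp add: d_def s_def)
  have "m \<noteq> 1" using nd by auto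
  then have m2: "m \<ge> 2" using m_pos by simp
  have prime_d: "l dvd d" if "Factorial_Ring.prime l" "l dvd m" for l
    using that prime_divisor_of_degree_dvd by (simp add: d_def)
  obtain l where l: "Factorial_Ring.prime l" "l dvd m"
    using prime_factor_nat[OF \<open>m \<noteq> 1\<close>] by blast
  have "d > 0" using m_pos m by (auto intro!: gr0I)
  then have d2: "d \<ge> 2"
    using dvd_imp_le[OF prime_d[OF l]] prime_ge_2_nat[OF l(1)] by linarith
  have "s \<noteq> 1" using nd m by (metis d_def gcd_dvd2 mult.right_neutral)
  moreover have "s \<noteq> 0" using m m_pos by (metis mult_0_right not_one_le_zero)
  ultimately have s2: "s \<ge> 2" by simp
  have ls: "l dvd d" if "Factorial_Ring.prime l" "l dvd s" for l
    using prime_d[of l] that m by (metis dvd_mult)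
  obtain B f e where p: "e \<ge> 1" "e dvd s" "d * e = B * f" "e * B = d * s"
    "2 powr sqrt (2 * real (d * s)) \<le> real ((B * f - 1 + B) choose B)"
    using balanced_tower_parameters[OF d2 s2 ls] by metis
  have "d * e dvd q ^ e - 1"
  proof (rule mult_dvd_power_pred)
    show "1 \<le> q" using card_base_ge_2 by simp
    show "l dvd d" if "Factorial_Ring.prime l" "l dvd e" for l
      using ls[OF that(1)] that(2) p(2) dvd_trans by blast
  qed (use p(1) in \<open>auto simp: d_def\<close>)
  obtain k where "s = e * k" using p(2) by (rule dvdE)
  then have "d * e * k = m" by (simp add: m)
  moreover note \<open>d * e dvd q ^ e - 1\<close> p(1)
  moreover have "e * B \<le> m" using p(4) m by simp
  moreover note b
  ultimately have "(d * e - 1 + B) choose B \<le> group.ord (Multiplicative_Group.mult_of R) (\<theta> \<oplus> b)"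
    by (rule ord_root_plus_const_ge_binomial[OF m2])
  then show ?thesis using p(5) unfolding p(3) m[symmetric] by linarith
qed

end

section \<open>Adjoining a root of an irreducible binomial\<close>

lemma (in field) binomial_poly_closed:
  assumes "a \<in> carrier R" and "m \<ge> 1"
  shows "binomial_poly R m a \<in> carrier (poly_ring R)" and "degree (binomial_poly R m a) = m"
proof -
  interpret UP: domain "poly_ring R" using univ_poly_is_domain[OF carrier_is_subring] .
  have X: "X \<in> carrier (poly_ring R)" using var_closed(1)[OF carrier_is_subring] .
  have a: "poly_of_const a \<in> carrier (poly_ring R)" "degree (poly_of_const a) = 0"
    using poly_of_const_over_carrier assms(1) by auto
  show "binomial_poly R m a \<in> carrier (poly_ring R)"
    unfolding binomial_poly_def using X a by simp
  have "degree (X [^]\<^bsub>poly_ring R\<^esub> m) = m"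
    using polynomial_pow_degree[OF X, of m] by (simp add: var_def)
  moreover have "degree (\<ominus>\<^bsub>poly_ring R\<^esub> poly_of_const a) = 0"
    using univ_poly_a_inv_degree[OF carrier_is_subring a(1)] a(2) by simp
  ultimately show "degree (binomial_poly R m a) = m"
    unfolding binomial_poly_def UP.minus_eq
    using poly_add_degree_eq[OF carrier_is_subring, of "X [^]\<^bsub>poly_ring R\<^esub> m" "\<ominus>\<^bsub>poly_ring R\<^esub> poly_of_const a"]
      assms(2) X a(1) by (simp add: univ_poly_add univ_poly_carrier)
qed

text \<open>
  The canonical surjection embeds the constants, and the coset of \<open>X\<close> generates the quotient because
  every polynomial is its own value at \<open>X\<close>. The last two claims let the order of the base field and
  the condition \<open>b \<noteq> 0\<close> be transported to the image of the base field.
\<close>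

lemma (in field) radical_extension_binomial_ext:
  fixes a m
  defines "p \<equiv> binomial_poly R m a"
  assumes fin: "finite (carrier R)" and a: "a \<in> carrier R" and m: "m \<ge> 1"
    and irr: "pirreducible (carrier R) p"
  shows "radical_extension (Rupt (carrier R) p)
      (rupture_surj (carrier R) p ` poly_of_const ` carrier R) (rupture_surj (carrier R) p X) m"
    and "card (rupture_surj (carrier R) p ` poly_of_const ` carrier R) = card (carrier R)"
    and "inj_on (rupture_surj (carrier R) p \<circ> poly_of_const) (carrier R)"
proof -
  let ?K = "Rupt (carrier R) p"
  let ?h = "rupture_surj (carrier R) p"
  let ?F = "?h ` poly_of_const ` carrier R"
  interpret UP: domain "poly_ring R" using univ_poly_is_domain[OF carrier_is_subring] .
  have p: "p \<in> carrier (poly_ring R)" "degree p = m"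
    unfolding p_def using binomial_poly_closed[OF a m] by auto
  interpret K: field ?K
    using rupture_is_field_iff_pirreducible[OF carrier_is_subfield p(1)] irr by simp
  interpret H: ring_hom_ring "poly_ring R" ?K ?h
    using rupture_surj_hom(2)[OF carrier_is_subring p(1)] .
  have X: "X \<in> carrier (poly_ring R)" using var_closed(1)[OF carrier_is_subring] .
  have hX: "?h X \<in> carrier ?K" using H.hom_closed[OF X] .
  have cst: "subfield (poly_of_const ` carrier R) (poly_ring R)"
    by (rule univ_poly_subfield_of_consts[OF carrier_is_subfield])
  have subf: "subfield ?F ?K" and inj: "inj_on ?h (poly_of_const ` carrier R)"
    using H.img_is_subfield[OF cst K.one_not_zero] by auto
  have inj_const: "inj_on poly_of_const (carrier R)"
    by (auto simp: inj_on_def poly_of_const_def split: if_splits)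
  show "inj_on (?h \<circ> poly_of_const) (carrier R)" by (rule comp_inj_on[OF inj_const inj])
  show cardF: "card ?F = card (carrier R)"
    using inj inj_const by (simp add: card_image)
  have finF: "finite ?F" using fin by simp
  have dim: "K.dimension m ?F (carrier ?K)"
    using rupture_dimension[OF carrier_is_subfield p(1)] p(2) m by simp
  have "card (carrier ?K) = card ?F ^ m"
    by (rule K.card_of_dimension[OF subf finF dim])
  moreover have "card ?F \<noteq> 0" unfolding cardF using fin zero_closed by auto
  ultimately have finK: "finite (carrier ?K)" by (metis card.infinite power_not_zero)
  interpret E: finite_field_extension ?K ?F
    by (intro finite_field_extension.intro finite_field_extension_axioms.intro
        K.field_axioms finK subf)
  have "?h p = PIdl\<^bsub>poly_ring R\<^esub> p"
    by (rule UP.a_rcos_zero[OF UP.cgenideal_ideal[OF p(1)] UP.cgenideal_self[OF p(1)]])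
  then have hp: "?h p = \<zero>\<^bsub>?K\<^esub>"
    by (simp only: rupture_def FactRing_def ring.simps)
  have ca: "poly_of_const a \<in> carrier (poly_ring R)" using subfieldE(3)[OF cst] a by auto
  have "?h X [^]\<^bsub>?K\<^esub> m = ?h (X [^]\<^bsub>poly_ring R\<^esub> m)" using H.hom_nat_pow[OF X] by simp
  also have "X [^]\<^bsub>poly_ring R\<^esub> m = p \<oplus>\<^bsub>poly_ring R\<^esub> poly_of_const a"
    unfolding p_def binomial_poly_def using X ca by (simp add: UP.minus_eq UP.a_assoc UP.l_neg)
  also have "?h \<dots> = ?h (poly_of_const a)"
    using H.hom_add[OF p(1) ca] hp H.hom_closed[OF ca] by simp
  finally have power: "?h X [^]\<^bsub>?K\<^esub> m \<in> ?F" using a by auto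
  have gen: "K.simple_extension ?F (?h X) = carrier ?K"
  proof
    show "K.simple_extension ?F (?h X) \<subseteq> carrier ?K"
      by (rule K.simple_extension_in_carrier[OF E.base_incl hX])
    show "carrier ?K \<subseteq> K.simple_extension ?F (?h X)"
    proof
      fix z assume "z \<in> carrier ?K"
      then obtain g where g: "g \<in> carrier (poly_ring R)" "z = ?h g"
        unfolding rupture_def FactRing_def A_RCOSETS_def' by auto
      have "K.eval (map (?h \<circ> poly_of_const) g) (?h X) = ?h (UP.eval (map poly_of_const g) X)"
        using H.eval_hom[OF UP.carrier_is_subring X map_norm_in_poly_ring_carrier[OF carrier_is_subring g(1)]]
        by simp
      also have "\<dots> = z" using eval_rewrite[OF carrier_is_subring g(1)] g(2) by simp
      finally have "z = K.eval (map (?h \<circ> poly_of_const) g) (?h X)" by simp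
      moreover have "set (map (?h \<circ> poly_of_const) g) \<subseteq> ?F"
        using polynomial_in_carrier[OF carrier_is_subring] g(1) by (auto simp: univ_poly_carrier[symmetric])
      ultimately show "z \<in> K.simple_extension ?F (?h X)"
        using K.eval_in_simple_extension[OF E.base_incl hX] by simp
    qed
  qed
  have "K.dimension (degree (K.Irr ?F (?h X))) ?F (carrier ?K)"
    using K.dimension_simple_extension[OF subf hX E.algebraic_over_subfield[OF subf hX]] gen by simp
  then have "degree (K.Irr ?F (?h X)) = m"
    using K.dimension_is_inj[OF subf] dim by blast
  then show "radical_extension ?K ?F (?h X) m"
    using hX power gen m by unfold_locales auto
qed

theorem theorem1:
  fixes F :: "('a, 'b) ring_scheme"
    and p n q m :: nat
    and a b :: 'a
  assumes "Factorial_Ring.prime p" and "odd p" and "n \<ge> 1" and "q = p ^ n" and "q \<ge> 5"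
    and "field F" and "finite (carrier F)" and "order F = q"
    and "m \<ge> 1" and "\<not> m dvd q - 1"
    and "a \<in> carrier F"
    and "pirreducible\<^bsub>F\<^esub> (carrier F) (binomial_poly F m a)"
    and "b \<in> carrier F" and "b \<noteq> \<zero>\<^bsub>F\<^esub>"
  shows "real (group.ord (Multiplicative_Group.mult_of (binomial_ext F m a))
            (binomial_root F m a \<oplus>\<^bsub>binomial_ext F m a\<^esub> binomial_const F m a b))
         \<ge> 2 powr sqrt (2 * real m)"
proof -
  interpret field F by fact
  let ?h = "rupture_surj (carrier F) (binomial_poly F m a)"
  interpret H: ring_hom_ring "poly_ring F" "Rupt\<^bsub>F\<^esub> (carrier F) (binomial_poly F m a)" ?h
    using rupture_surj_hom(2)[OF carrier_is_subring binomial_poly_closed(1)[OF assms(11,9)]] .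
  note ext = radical_extension_binomial_ext[OF assms(7,11,9,12)]
  interpret E: radical_extension "binomial_ext F m a" "?h ` poly_of_const ` carrier F"
      "binomial_root F m a" m
    using ext(1) by (simp add: binomial_ext_def binomial_root_def binomial_coset_def)
  have "\<not> m dvd card (?h ` poly_of_const ` carrier F) - 1"
    unfolding ext(2) using assms(8,10) by (simp add: order_def)
  moreover have bF: "binomial_const F m a b \<in> ?h ` poly_of_const ` carrier F"
    unfolding binomial_const_def binomial_coset_def using assms(13) by auto
  moreover have "binomial_const F m a b \<noteq> \<zero>\<^bsub>binomial_ext F m a\<^esub>"
  proof
    assume "binomial_const F m a b = \<zero>\<^bsub>binomial_ext F m a\<^esub>"
    moreover have "(?h \<circ> poly_of_const) \<zero>\<^bsub>F\<^esub> = \<zero>\<^bsub>binomial_ext F m a\<^esub>"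
      using H.hom_zero by (simp add: poly_of_const_def univ_poly_zero binomial_ext_def)
    ultimately have "(?h \<circ> poly_of_const) b = (?h \<circ> poly_of_const) \<zero>\<^bsub>F\<^esub>"
      by (simp add: binomial_const_def binomial_coset_def)
    then have "b = \<zero>\<^bsub>F\<^esub>" by (rule inj_onD[OF ext(3) _ assms(13) zero_closed])
    then show False using assms(14) by simp
  qed
  ultimately show ?thesis by (rule E.ord_root_plus_const_ge)
qed

end
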